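(* There exist finite non-empty alphabets $\mathcal{A},\mathcal{B}$, a subshift $X\subseteq\mathcal{A}^{\mathbb{Z}}$ and a (non-erasing) morphism $\sigma:\mathcal{A}^*\to\mathcal{B}^*$ which is not recognizable for aperiodic points in $X$, while the induced measure transfer map $\sigma_X^{\mathcal{M}}:\mathcal{M}(X)\to\mathcal{M}(\sigma(X))$ is injective.
   Context: For a finite non-empty alphabet $\mathcal{A}$, $\mathcal{A}^*$ is the free monoid of finite words, $|w|$ is word length. The full shift $\mathcal{A}^{\mathbb{Z}}$ carries the product topology and the shift $T$, $(T\mathbf{x})_k=x_{k+1}$. The cylinder of $w$ is $[w]=\{\mathbf{x}: x_1\cdots x_{|w|}=w\}$. A subshift is a non-empty closed subset $X\subseteq\mathcal{A}^{\mathbb{Z}}$ with $T(X)=X$. A biinfinite word $\mathbf{y}$ is periodic if $T^m(\mathbf{y})=\mathbf{y}$ for some $m\ge1$. A monoid morphism $\sigma:\mathcal{A}^*\to\mathcal{B}^*$ is non-erasing if $|\sigma(a)|\ge1$ for all $a\in\mathcal{A}$. It induces $\sigma^{\mathbb{Z}}:\mathcal{A}^{\mathbb{Z}}\to\mathcal{B}^{\mathbb{Z}}$ by concatenating the words $\sigma(x_i)$, with $\sigma(x_1)$ starting at position $1$. The image subshift $\sigma(X)$ is the intersection of all subshifts of $\mathcal{B}^{\mathbb{Z}}$ containing $\sigma^{\mathbb{Z}}(X)$. The morphism $\sigma$ is recognizable for aperiodic points in $X$ if the following holds: whenever $\mathbf{x},\mathbf{x}'\in X$ and $\mathbf{y}\in\mathcal{B}^{\mathbb{Z}}$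 is not periodic, and $\mathbf{y}=T^k(\sigma^{\mathbb{Z}}(\mathbf{x}))=T^\ell(\sigma^{\mathbb{Z}}(\mathbf{x}'))$ for integers $0\le k\le|\sigma(x_1)|-1$ and $0\le\ell\le|\sigma(x'_1)|-1$ (where $x_1,x_1'$ are the letters of $\mathbf{x},\mathbf{x}'$ at position $1$), then $\mathbf{x}=\mathbf{x}'$ and $k=\ell$. An invariant measure on $X$ is a finite $T$-invariant Borel measure on $\mathcal{A}^{\mathbb{Z}}$ with support in $X$; $\mathcal{M}(X)$ is the set of those. Measure transfer: for non-erasing $\sigma$ let $\mathcal{A}_\sigma$ be the alphabet of letters $a(k)$ with $a\in\mathcal{A}$, $1\le k\le|\sigma(a)|$; let $\pi_\sigma:\mathcal{A}^*\to\mathcal{A}_\sigma^*$, $a\mapsto a(1)a(2)\cdots a(|\sigma(a)|)$, and let $\alpha_\sigma:\mathcal{A}_\sigma^*\to\mathcal{B}^*$ send $a(k)$ to the $k$-th letter of $\sigma(a)$, so that $\sigma=\alpha_\sigma\circ\pi_\sigma$. For a non-empty word $u\in\mathcal{A}_\sigma^*$ let $\hat u\in\mathcal{A}^*$ be the shortest word such that $u$ is a factor (contiguous subword) of $\pi_\sigma(\hat u)$ (it is unique if it exists); if no such word exists, put formally $\mu([\hat u])=0$. For $\mu\in\mathcal{M}(\mathcal{A}^{\mathbb{Z}})$, the transferred measure $\mu^\sigma=\sigma^{\mathcal{M}}(\mu)\in\mathcal{M}(\mathcal{B}^{\mathbb{Z}})$ is the invariant measure determined by $\mu^\sigma([w])=\sum_{u\in\alpha_\sigma^{-1}(w)}\mu([\hat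 u])$ for all non-empty $w\in\mathcal{B}^*$. The map $\sigma_X^{\mathcal{M}}:\mathcal{M}(X)\to\mathcal{M}(\sigma(X))$ is the restriction $\mu\mapsto\mu^\sigma$ (which is known to take values in $\mathcal{M}(\sigma(X))$). *)

theory Defs
  imports "HOL-Analysis.Analysis" "HOL-Library.Sublist"
begin

text \<open>Alphabets are finite non-empty sets \<open>A :: 'a set\<close>; words over \<open>A\<close> are the elements of
  \<open>lists A\<close>; biinfinite words are functions on \<open>int\<close>.\<close>

definition alphabet :: "'a set \<Rightarrow> bool" where
  "alphabet A \<longleftrightarrow> finite A \<and> A \<noteq> {}"

definition shift_topology :: "'a set \<Rightarrow> (int \<Rightarrow> 'a) topology" where
  "shift_topology A = product_topology (\<lambda>_. discrete_topology A) UNIV"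

definition full_shift :: "'a set \<Rightarrow> (int \<Rightarrow> 'a) set" where
  "full_shift A = {x. \<forall>k. x k \<in> A}"

definition shift_map :: "(int \<Rightarrow> 'a) \<Rightarrow> int \<Rightarrow> 'a" where
  "shift_map x = (\<lambda>k. x (k + 1))"

definition cylinder :: "'a set \<Rightarrow> 'a list \<Rightarrow> (int \<Rightarrow> 'a) set" where
  "cylinder A w = {x \<in> full_shift A. map x [1..int (length w)] = w}"

definition subshift :: "'a set \<Rightarrow> (int \<Rightarrow> 'a) set \<Rightarrow> bool" where
  "subshift A X \<longleftrightarrow> X \<noteq> {} \<and> closedin (shift_topology A) X \<and> shift_map ` X = X"

definition periodic_word :: "(int \<Rightarrow> 'a) \<Rightarrow> bool" where
  "periodic_word y \<longleftrightarrow> (\<exists>m\<ge>1. (shift_map ^^ m) y = y)"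

text \<open>A morphism from \<open>lists A\<close> to \<open>lists B\<close> is given by the images of the letters (the free monoid
  is generated by them); \<open>extend \<sigma>\<close> is the monoid morphism itself.\<close>

definition extend :: "('a \<Rightarrow> 'b list) \<Rightarrow> 'a list \<Rightarrow> 'b list" where
  "extend \<sigma> w = concat (map \<sigma> w)"

definition word_morphism :: "'a set \<Rightarrow> 'b set \<Rightarrow> ('a \<Rightarrow> 'b list) \<Rightarrow> bool" where
  "word_morphism A B \<sigma> \<longleftrightarrow> (\<forall>a\<in>A. \<sigma> a \<in> lists B)"

definition non_erasing :: "'a set \<Rightarrow> ('a \<Rightarrow> 'b list) \<Rightarrow> bool" where
  "non_erasing A \<sigma> \<longleftrightarrow> (\<forall>a\<in>A. length (\<sigma> a) \<ge> 1)"

text \<open>\<open>block_start \<sigma> x i\<close> is the position of the first letter of \<open>\<sigma> (x i)\<close> in the biinfinite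
  concatenation of the words \<open>\<sigma> (x i)\<close> in which \<open>\<sigma> (x 1)\<close> starts at position 1.\<close>

definition block_start :: "('a \<Rightarrow> 'b list) \<Rightarrow> (int \<Rightarrow> 'a) \<Rightarrow> int \<Rightarrow> int" where
  "block_start \<sigma> x i =
     (if i \<ge> 1 then 1 + (\<Sum>j\<in>{1..<i}. int (length (\<sigma> (x j))))
      else 1 - (\<Sum>j\<in>{i..<1}. int (length (\<sigma> (x j)))))"

text \<open>For non-erasing \<open>\<sigma>\<close>, every position \<open>n\<close> lies in exactly one block.\<close>

definition biinfinite_image :: "('a \<Rightarrow> 'b list) \<Rightarrow> (int \<Rightarrow> 'a) \<Rightarrow> int \<Rightarrow> 'b" where
  "biinfinite_image \<sigma> x = (\<lambda>n.
     let i = (THE i. block_start \<sigma> x i \<le> n \<and> n < block_start \<sigma> x (i + 1))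
     in \<sigma> (x i) ! nat (n - block_start \<sigma> x i))"

definition image_subshift :: "'b set \<Rightarrow> ('a \<Rightarrow> 'b list) \<Rightarrow> (int \<Rightarrow> 'a) set \<Rightarrow> (int \<Rightarrow> 'b) set" where
  "image_subshift B \<sigma> X = \<Inter> {Y. subshift B Y \<and> biinfinite_image \<sigma> ` X \<subseteq> Y}"

definition recognizable_aperiodic ::
    "'b set \<Rightarrow> ('a \<Rightarrow> 'b list) \<Rightarrow> (int \<Rightarrow> 'a) set \<Rightarrow> bool" where
  "recognizable_aperiodic B \<sigma> X \<longleftrightarrow>
     (\<forall>x\<in>X. \<forall>x'\<in>X. \<forall>y\<in>full_shift B. \<forall>k l :: nat.
        \<not> periodic_word y \<longrightarrow>
        k < length (\<sigma> (x 1)) \<longrightarrow> l < length (\<sigma> (x' 1)) \<longrightarrow>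
        y = (shift_map ^^ k) (biinfinite_image \<sigma> x) \<longrightarrow>
        y = (shift_map ^^ l) (biinfinite_image \<sigma> x') \<longrightarrow>
        x = x' \<and> k = l)"

definition shift_borel :: "'a set \<Rightarrow> (int \<Rightarrow> 'a) measure" where
  "shift_borel A = sigma (full_shift A) {U. openin (shift_topology A) U}"

definition measure_support :: "'a set \<Rightarrow> (int \<Rightarrow> 'a) measure \<Rightarrow> (int \<Rightarrow> 'a) set" where
  "measure_support A \<mu> =
     {x \<in> full_shift A. \<forall>U. openin (shift_topology A) U \<and> x \<in> U \<longrightarrow> emeasure \<mu> U > 0}"

definition invariant_measures :: "'a set \<Rightarrow> (int \<Rightarrow> 'a) set \<Rightarrow> (int \<Rightarrow> 'a) measure set" where
  "invariant_measures A X =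
     {\<mu>. sets \<mu> = sets (shift_borel A) \<and> finite_measure \<mu> \<and>
         (\<forall>E\<in>sets \<mu>. emeasure \<mu> (shift_map -` E \<inter> space \<mu>) = emeasure \<mu> E) \<and>
         measure_support A \<mu> \<subseteq> X}"

text \<open>The letter \<open>a(k)\<close> of the subdivided alphabet is the pair \<open>(a, k)\<close>, with \<open>k\<close> counted from 1.\<close>

definition sub_alphabet :: "'a set \<Rightarrow> ('a \<Rightarrow> 'b list) \<Rightarrow> ('a \<times> nat) set" where
  "sub_alphabet A \<sigma> = {(a, k). a \<in> A \<and> 1 \<le> k \<and> k \<le> length (\<sigma> a)}"

definition sub_pi :: "('a \<Rightarrow> 'b list) \<Rightarrow> 'a \<Rightarrow> ('a \<times> nat) list" where
  "sub_pi \<sigma> a = map (\<lambda>k. (a, k)) [1..<Suc (length (\<sigma> a))]"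

definition sub_alpha :: "('a \<Rightarrow> 'b list) \<Rightarrow> ('a \<times> nat) \<Rightarrow> 'b list" where
  "sub_alpha \<sigma> = (\<lambda>(a, k). [\<sigma> a ! (k - 1)])"

definition covers :: "'a set \<Rightarrow> ('a \<Rightarrow> 'b list) \<Rightarrow> ('a \<times> nat) list \<Rightarrow> 'a list \<Rightarrow> bool" where
  "covers A \<sigma> u v \<longleftrightarrow> v \<in> lists A \<and> sublist u (extend (sub_pi \<sigma>) v)"

definition hat_word :: "'a set \<Rightarrow> ('a \<Rightarrow> 'b list) \<Rightarrow> ('a \<times> nat) list \<Rightarrow> 'a list" where
  "hat_word A \<sigma> u = (THE v. is_arg_min length (covers A \<sigma> u) v)"

definition hat_mass ::
    "'a set \<Rightarrow> ('a \<Rightarrow> 'b list) \<Rightarrow> (int \<Rightarrow> 'a) measure \<Rightarrow> ('a \<times> nat) list \<Rightarrow> real" where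
  "hat_mass A \<sigma> \<mu> u =
     (if \<exists>v. covers A \<sigma> u v then measure \<mu> (cylinder A (hat_word A \<sigma> u)) else 0)"

definition measure_transfer ::
    "'a set \<Rightarrow> 'b set \<Rightarrow> ('a \<Rightarrow> 'b list) \<Rightarrow> (int \<Rightarrow> 'a) measure \<Rightarrow> (int \<Rightarrow> 'b) measure" where
  "measure_transfer A B \<sigma> \<mu> =
     (THE \<nu>. \<nu> \<in> invariant_measures B (full_shift B) \<and>
        (\<forall>w\<in>lists B. w \<noteq> [] \<longrightarrow>
           measure \<nu> (cylinder B w) =
             (\<Sum>u\<in>{u \<in> lists (sub_alphabet A \<sigma>). extend (sub_alpha \<sigma>) u = w}. hat_mass A \<sigma> \<mu> u)))"

definition measure_transfer_on ::
    "'a set \<Rightarrow> 'b set \<Rightarrow> ('a \<Rightarrow> 'b list) \<Rightarrow> (int \<Rightarrow> 'a) set \<Rightarrow>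
       (int \<Rightarrow> 'a) measure \<Rightarrow> (int \<Rightarrow> 'b) measure" where
  "measure_transfer_on A B \<sigma> X = restrict (measure_transfer A B \<sigma>) (invariant_measures A X)"

end

theory Submission imports Defs begin

text \<open>
  Recognizability constrains every point of \<open>X\<close>, whereas invariant measures see only the points
  that orbits return to. The example exploits this gap: the non-recognizability sits on wandering
  points, which carry no invariant mass.

  Over the letters \<open>0, 1, 2\<close> let \<open>X\<close> consist of the biinfinite words with at most one non-zero
  letter, and let \<open>\<sigma>\<close> fix \<open>0\<close> and send both \<open>1\<close> and \<open>2\<close> to \<open>1\<close>. The words with a single \<open>1\<close>,
  respectively a single \<open>2\<close>, at position \<open>1\<close> have the same aperiodic image, so \<open>\<sigma>\<close> is not
  recognizable for aperiodic points in \<open>X\<close>.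

  For an invariant measure on \<open>X\<close> the events that position \<open>k\<close> carries a non-zero letter all have
  the same mass and are pairwise disjoint up to null sets; since the measure is finite, this mass
  is \<open>0\<close> (\<open>nonzero_letter_null_of_sparse_support\<close>). Hence the measure is a point mass at the
  constant word \<open>0\<close> (\<open>emeasure_of_nonzero_letter_null\<close>). The same concentration principle, applied
  on the target side, shows that the cylinder formula is solved by exactly one invariant measure,
  the point mass with the same total mass (\<open>measure_transfer_eq_zero_point_mass\<close>). Since a point
  mass is determined by its total mass, the transfer map is injective.
\<close>

section \<open>The shift space as a compact measurable space\<close>

lemma topspace_shift_topology [simp]: "topspace (shift_topology A) = full_shift A"
  by (auto simp: shift_topology_def full_shift_def PiE_def Pi_def)

lemma space_shift_borel [simp]: "space (shift_borel A) = full_shift A"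
  unfolding shift_borel_def
  by (rule space_measure_of) (use openin_subset in fastforce)

lemma sets_shift_borel: "sets (shift_borel A) = sigma_sets (full_shift A) {U. openin (shift_topology A) U}"
  unfolding shift_borel_def
  by (rule sets_measure_of) (use openin_subset in fastforce)

lemma openin_sets_shift_borel: "openin (shift_topology A) U \<Longrightarrow> U \<in> sets (shift_borel A)"
  unfolding sets_shift_borel by blast

lemma compact_space_shift_topology: "finite A \<Longrightarrow> compact_space (shift_topology A)"
  unfolding shift_topology_def
  by (simp add: compact_space_product_topology compact_space_discrete_topology)

lemma continuous_map_letter:
  "continuous_map (shift_topology A) (discrete_topology A) (\<lambda>x. x k)"
  unfolding shift_topology_def by (rule continuous_map_product_projection) simp

lemma openin_letter: "openin (shift_topology A) {x \<in> full_shift A. x k \<in> S}"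
proof -
  have "openin (shift_topology A) {x \<in> topspace (shift_topology A). x k \<in> S \<inter> A}"
    by (rule openin_continuous_map_preimage[OF continuous_map_letter]) simp
  moreover have "{x \<in> topspace (shift_topology A). x k \<in> S \<inter> A} = {x \<in> full_shift A. x k \<in> S}"
    by (auto simp: full_shift_def)
  ultimately show ?thesis by simp
qed

lemma closedin_letter: "closedin (shift_topology A) {x \<in> full_shift A. x k \<in> S}"
proof -
  have "full_shift A - {x \<in> full_shift A. x k \<in> S} = {x \<in> full_shift A. x k \<in> - S}" by auto
  then show ?thesis
    using openin_letter[of A k "- S"] by (auto simp: closedin_def)
qed

lemma letter_in_sets: "{x \<in> full_shift A. x k \<in> S} \<in> sets (shift_borel A)"
  by (rule openin_sets_shift_borel[OF openin_letter])

lemma shift_map_in_full_shift: "x \<in> full_shift A \<Longrightarrow> shift_map x \<in> full_shift A"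
  by (simp add: full_shift_def shift_map_def)

lemma measurable_shift_map: "shift_map \<in> measurable (shift_borel A) (shift_borel A)"
proof -
  have cont: "continuous_map (shift_topology A) (shift_topology A) shift_map"
    unfolding shift_topology_def
    by (subst continuous_map_componentwise_UNIV)
      (auto simp: shift_map_def intro: continuous_map_product_projection)
  show ?thesis
  proof (rule measurable_sigma_sets[OF sets_shift_borel])
    show "{U. openin (shift_topology A) U} \<subseteq> Pow (full_shift A)"
      using openin_subset by fastforce
    show "shift_map \<in> space (shift_borel A) \<rightarrow> full_shift A"
      by (auto intro: shift_map_in_full_shift)
    fix U assume "U \<in> {U. openin (shift_topology A) U}"
    then have "openin (shift_topology A) {x \<in> topspace (shift_topology A). shift_map x \<in> U}"
      using openin_continuous_map_preimage[OF cont] by simp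
    moreover have "{x \<in> topspace (shift_topology A). shift_map x \<in> U}
        = shift_map -` U \<inter> space (shift_borel A)" by auto
    ultimately show "shift_map -` U \<inter> space (shift_borel A) \<in> sets (shift_borel A)"
      by (simp add: openin_sets_shift_borel)
  qed
qed

lemma cylinder_eq_Inter:
  "cylinder A w = full_shift A \<inter> (\<Inter>i\<in>{..<length w}. {x \<in> full_shift A. x (int i + 1) \<in> {w ! i}})"
proof -
  have "map x [1..int (length w)] = w \<longleftrightarrow> (\<forall>i<length w. x (int i + 1) = w ! i)" for x
    by (subst list_eq_iff_nth_eq) (auto simp: add.commute[of _ 1])
  then show ?thesis unfolding cylinder_def by blast
qed

lemma cylinder_in_sets: "cylinder A w \<in> sets (shift_borel A)"
proof (cases "w = []")
  case True
  then have "cylinder A w = space (shift_borel A)" by (auto simp: cylinder_def)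
  then show ?thesis by (metis sets.top)
next
  case False
  then show ?thesis
    unfolding cylinder_eq_Inter
    by (intro sets.Int sets.finite_INT letter_in_sets) (auto simp flip: space_shift_borel)
qed

section \<open>Invariant measures that avoid non-zero letters\<close>

lemma invariant_measuresD:
  assumes "\<mu> \<in> invariant_measures A X"
  shows "sets \<mu> = sets (shift_borel A)" "space \<mu> = full_shift A" "finite_measure \<mu>"
    "\<And>E. E \<in> sets (shift_borel A) \<Longrightarrow>
        emeasure \<mu> (shift_map -` E \<inter> full_shift A) = emeasure \<mu> E"
    "measure_support A \<mu> \<subseteq> X"
proof -
  show s: "sets \<mu> = sets (shift_borel A)" using assms by (simp add: invariant_measures_def)
  show sp: "space \<mu> = full_shift A" using sets_eq_imp_space_eq[OF s] by simp
  show "finite_measure \<mu>" "measure_support A \<mu> \<subseteq> X"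
    using assms by (simp_all add: invariant_measures_def)
  have "\<forall>E\<in>sets \<mu>. emeasure \<mu> (shift_map -` E \<inter> space \<mu>) = emeasure \<mu> E"
    using assms by (simp add: invariant_measures_def)
  then show "emeasure \<mu> (shift_map -` E \<inter> full_shift A) = emeasure \<mu> E"
    if "E \<in> sets (shift_borel A)" for E
    using that unfolding s sp by blast
qed

text \<open>Each point off the support has a null open neighbourhood, and finitely many of these
  cover a compact set.\<close>

lemma compact_off_support_null:
  assumes sets: "sets \<mu> = sets (shift_borel A)"
    and K: "compactin (shift_topology A) K" "K \<inter> measure_support A \<mu> = {}"
  shows "emeasure \<mu> K = 0"
proof -
  have sub: "K \<subseteq> full_shift A" using compactin_subset_topspace[OF K(1)] by simp
  have "\<forall>x\<in>K. \<exists>U. openin (shift_topology A) U \<and> x \<in> U \<and> emeasure \<mu> U = 0"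
  proof
    fix x assume "x \<in> K"
    then have "x \<in> full_shift A" "x \<notin> measure_support A \<mu>" using K(2) sub by auto
    then obtain U where "openin (shift_topology A) U" "x \<in> U" "\<not> emeasure \<mu> U > 0"
      unfolding measure_support_def by blast
    then show "\<exists>U. openin (shift_topology A) U \<and> x \<in> U \<and> emeasure \<mu> U = 0"
      by (metis not_gr_zero)
  qed
  then obtain U where U: "\<And>x. x \<in> K \<Longrightarrow> openin (shift_topology A) (U x)"
      "\<And>x. x \<in> K \<Longrightarrow> x \<in> U x" "\<And>x. x \<in> K \<Longrightarrow> emeasure \<mu> (U x) = 0"
    by metis
  obtain F where F: "finite F" "F \<subseteq> U ` K" "K \<subseteq> \<Union>F"
    using compactinD[OF K(1), of "U ` K"] U by blast
  have "V \<in> null_sets \<mu>" if V: "V \<in> F" for V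
  proof -
    obtain x where "x \<in> K" "V = U x" using V F(2) by blast
    then show ?thesis
      using U(3) openin_sets_shift_borel[OF U(1)] by (auto simp: null_sets_def sets)
  qed
  then have "\<Union>F \<in> null_sets \<mu>"
    using F(1) by (intro null_sets.finite_Union) auto
  then have "emeasure \<mu> (\<Union>F) = 0" "\<Union>F \<in> sets \<mu>" by (auto simp: null_sets_def)
  then show ?thesis
    using emeasure_mono[OF F(3)] by (metis le_zero_eq)
qed

lemma emeasure_letter_shift_invariant:
  assumes "\<mu> \<in> invariant_measures A X"
  shows "emeasure \<mu> {x \<in> full_shift A. x k \<in> S} = emeasure \<mu> {x \<in> full_shift A. x 1 \<in> S}"
proof -
  have step: "emeasure \<mu> {x \<in> full_shift A. x (j + 1) \<in> S} = emeasure \<mu> {x \<in> full_shift A. x j \<in> S}"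
    for j
  proof -
    have eq: "shift_map -` {x \<in> full_shift A. x j \<in> S} \<inter> full_shift A
        = {x \<in> full_shift A. x (j + 1) \<in> S}"
      using shift_map_in_full_shift by (auto simp: shift_map_def)
    show ?thesis
      using invariant_measuresD(4)[OF assms letter_in_sets, of j S] by (simp only: eq)
  qed
  show ?thesis
  proof (induction k rule: int_induct[where k = 1])
    case (step2 i)
    then show ?case using step[of "i - 1"] by simp
  qed (use step in auto)
qed

definition zero_word :: "int \<Rightarrow> nat" where "zero_word = (\<lambda>_. 0)"

lemma zero_word_in_full_shift: "zero_word \<in> full_shift A \<longleftrightarrow> 0 \<in> A"
  by (simp add: zero_word_def full_shift_def)

lemma shift_map_zero_word: "shift_map zero_word = zero_word"
  by (simp add: shift_map_def zero_word_def)

lemma zero_word_in_cylinder: "0 \<in> A \<Longrightarrow> zero_word \<in> cylinder A w \<longleftrightarrow> w = replicate (length w) 0"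
  unfolding cylinder_def mem_Collect_eq zero_word_in_full_shift
  by (subst eq_commute[of w]) (simp add: zero_word_def map_replicate_const)

text \<open>By invariance a non-zero letter has probability \<open>0\<close> at every position, and there are only
  countably many positions.\<close>

lemma emeasure_of_nonzero_letter_null:
  fixes \<mu> :: "(int \<Rightarrow> nat) measure"
  assumes \<mu>: "\<mu> \<in> invariant_measures A X"
    and null: "emeasure \<mu> {x \<in> full_shift A. x 1 \<noteq> 0} = 0"
    and E: "E \<in> sets (shift_borel A)"
  shows "emeasure \<mu> E = (if zero_word \<in> E then emeasure \<mu> (full_shift A) else 0)"
proof -
  note sets = invariant_measuresD(1)[OF \<mu>] and space = invariant_measuresD(2)[OF \<mu>]
  have "emeasure \<mu> {x \<in> full_shift A. x k \<noteq> 0} = 0" for k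
    using emeasure_letter_shift_invariant[OF \<mu>, of k "- {0}"] null by simp
  then have "AE x in \<mu>. x k = 0" for k
    using letter_in_sets[of A k "- {0}"] 
    by (subst AE_iff_null) (auto simp: null_sets_def sets space)
  then have "AE x in \<mu>. \<forall>k. x k = 0" by (simp add: AE_all_countable)
  then have ae: "AE x in \<mu>. x = zero_word" by eventually_elim (auto simp: zero_word_def)
  show ?thesis
  proof (cases "zero_word \<in> E")
    case True
    have zw: "zero_word \<in> full_shift A" using True sets.sets_into_space[OF E] by auto
    have top: "full_shift A \<in> sets \<mu>" using sets.top[of \<mu>] space by simp
    have "AE x in \<mu>. x \<in> E \<longleftrightarrow> x \<in> full_shift A"
      using ae by eventually_elim (use True zw in simp)
    then have "emeasure \<mu> E = emeasure \<mu> (full_shift A)"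
      by (rule emeasure_eq_AE) (use E top in \<open>simp_all add: sets\<close>)
    with True show ?thesis by simp
  next
    case False
    have "AE x in \<mu>. x \<in> E \<longleftrightarrow> x \<in> {}"
      using ae by eventually_elim (use False in simp)
    then have "emeasure \<mu> E = emeasure \<mu> {}"
      by (rule emeasure_eq_AE) (use E in \<open>simp_all add: sets\<close>)
    with False show ?thesis by simp
  qed
qed

section \<open>Words with at most one non-zero letter\<close>

definition sparse_words :: "nat set \<Rightarrow> (int \<Rightarrow> nat) set" where
  "sparse_words A = {x \<in> full_shift A. \<forall>j k. j \<noteq> k \<longrightarrow> x j = 0 \<or> x k = 0}"

lemma translate_in_sparse_words:
  assumes "x \<in> sparse_words A"
  shows "(\<lambda>k. x (k + n)) \<in> sparse_words A"
proof -
  have sparse: "\<forall>j k. j \<noteq> k \<longrightarrow> x j = 0 \<or> x k = 0"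
    using assms unfolding sparse_words_def by simp
  have "x (j + n) = 0 \<or> x (k + n) = 0" if "j \<noteq> k" for j k
    by (rule sparse[rule_format]) (use that in simp)
  then show ?thesis using assms by (simp add: sparse_words_def full_shift_def)
qed

lemma subshift_sparse_words:
  assumes "0 \<in> A"
  shows "subshift A (sparse_words A)"
  unfolding subshift_def
proof (intro conjI)
  show "sparse_words A \<noteq> {}"
    using assms by (auto simp: sparse_words_def full_shift_def intro: exI[of _ "\<lambda>_. 0"])
  have eq: "sparse_words A = full_shift A \<inter>
      (\<Inter>(j, k)\<in>{(j, k). j \<noteq> k}. {x \<in> full_shift A. x j = 0} \<union> {x \<in> full_shift A. x k = 0})"
    by (auto simp: sparse_words_def) (metis less_not_refl)
  have "(0::int, 1::int) \<in> {(j, k). j \<noteq> k}" by simp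
  then have "{(j::int, k::int). j \<noteq> k} \<noteq> {}" by blast
  then show "closedin (shift_topology A) (sparse_words A)"
    unfolding eq using closedin_topspace[of "shift_topology A"] closedin_letter[of A _ "{0}"]
    by (intro closedin_Int closedin_INT) (auto intro!: closedin_Un)
  show "shift_map ` sparse_words A = sparse_words A"
  proof
    show "shift_map ` sparse_words A \<subseteq> sparse_words A"
      using translate_in_sparse_words[of _ A 1] by (auto simp: shift_map_def)
    show "sparse_words A \<subseteq> shift_map ` sparse_words A"
    proof
      fix x assume "x \<in> sparse_words A"
      then have "(\<lambda>k. x (k - 1)) \<in> sparse_words A"
        using translate_in_sparse_words[of x A "- 1"] by simp
      then show "x \<in> shift_map ` sparse_words A"
        by (rule rev_image_eqI) (simp add: shift_map_def)
    qed
  qed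
qed

text \<open>Two positions cannot both carry a non-zero letter, so the events that position \<open>k\<close> does so
  are almost surely disjoint. A finite measure has no room for infinitely many such events of
  equal positive mass.\<close>

lemma nonzero_letter_null_of_sparse_support:
  assumes "finite A" and \<mu>: "\<mu> \<in> invariant_measures A (sparse_words A)"
  shows "emeasure \<mu> {x \<in> full_shift A. x 1 \<noteq> 0} = 0"
proof -
  note sets = invariant_measuresD(1)[OF \<mu>] and space = invariant_measuresD(2)[OF \<mu>]
  interpret finite_measure \<mu> by (rule invariant_measuresD(3)[OF \<mu>])
  define E where "E k = {x \<in> full_shift A. x k \<in> - {0}}" for k :: int
  \<comment> \<open>Countable additivity needs truly disjoint sets: remove the null overlaps.\<close>
  define D where "D k = E k - (\<Union>j\<in>- {k}. E j)" for k
  have E_sets: "E k \<in> sets \<mu>" for k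
    by (simp only: E_def sets letter_in_sets)
  have D_sets: "D k \<in> sets \<mu>" for k
    unfolding D_def by (intro sets.Diff sets.countable_UN' E_sets) (auto simp: E_sets)
  have null: "E j \<inter> E k \<in> null_sets \<mu>" if "j \<noteq> k" for j k
  proof -
    have "closedin (shift_topology A) (E j \<inter> E k)"
      unfolding E_def by (intro closedin_Int closedin_letter)
    then have "compactin (shift_topology A) (E j \<inter> E k)"
      using closedin_compact_space compact_space_shift_topology[OF assms(1)] by blast
    moreover have "(E j \<inter> E k) \<inter> measure_support A \<mu> = {}"
    proof -
      have "x j = 0 \<or> x k = 0" if "x \<in> sparse_words A" for x
        using that \<open>j \<noteq> k\<close> unfolding sparse_words_def by simp
      then show ?thesis using invariant_measuresD(5)[OF \<mu>] by (fastforce simp: E_def)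
    qed
    ultimately have "emeasure \<mu> (E j \<inter> E k) = 0"
      by (rule compact_off_support_null[OF sets])
    then show ?thesis using E_sets by (auto simp: null_sets_def)
  qed
  have "measure \<mu> (D k) = measure \<mu> (E 1)" for k
  proof -
    have "(\<Union>j\<in>- {k}. E k \<inter> E j) \<in> null_sets \<mu>"
      by (rule null_sets_UN') (auto intro: null)
    moreover have "D k = E k - (\<Union>j\<in>- {k}. E k \<inter> E j)" by (auto simp: D_def)
    ultimately have "emeasure \<mu> (D k) = emeasure \<mu> (E k)"
      by (simp add: emeasure_Diff_null_set E_sets)
    also have "\<dots> = emeasure \<mu> (E 1)"
      unfolding E_def by (rule emeasure_letter_shift_invariant[OF \<mu>])
    finally show ?thesis by (simp add: measure_def)
  qed
  moreover have "disjoint_family (\<lambda>n. D (int n))"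
    by (auto simp: disjoint_family_on_def D_def)
  then have "(\<lambda>n. measure \<mu> (D (int n))) sums measure \<mu> (\<Union>n. D (int n))"
    using D_sets by (intro finite_measure_UNION) auto
  ultimately have "(\<lambda>n::nat. measure \<mu> (E 1)) \<longlonglongrightarrow> 0"
    by (metis (no_types, lifting) sums_summable summable_LIMSEQ_zero ext)
  then have "measure \<mu> (E 1) = 0" by (simp add: LIMSEQ_const_iff)
  then show ?thesis by (simp add: E_def emeasure_eq_measure)
qed

section \<open>Letter-to-letter morphisms\<close>

context
  fixes f :: "'a \<Rightarrow> 'b" and \<sigma> :: "'a \<Rightarrow> 'b list"
  defines "\<sigma> \<equiv> \<lambda>a. [f a]"
begin

lemma block_start_letter_morphism: "block_start \<sigma> x i = i"
  by (simp add: block_start_def \<sigma>_def)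

lemma biinfinite_image_letter_morphism: "biinfinite_image \<sigma> x = (\<lambda>n. f (x n))"
proof
  fix n :: int
  have "(THE i. i \<le> n \<and> n < i + 1) = n" by (rule the_equality) auto
  then show "biinfinite_image \<sigma> x n = f (x n)"
    by (simp add: biinfinite_image_def block_start_letter_morphism Let_def) (simp add: \<sigma>_def)
qed

lemma sub_alphabet_letter_morphism: "sub_alphabet A \<sigma> = (\<lambda>a. (a, 1)) ` A"
  by (auto simp: sub_alphabet_def \<sigma>_def)

lemma extend_sub_pi_letter_morphism: "extend (sub_pi \<sigma>) v = map (\<lambda>a. (a, 1)) v"
  by (induction v) (auto simp: extend_def sub_pi_def \<sigma>_def)

lemma extend_sub_alpha_letter_morphism:
  "extend (sub_alpha \<sigma>) (map (\<lambda>a. (a, 1)) v) = map f v"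
  by (induction v) (auto simp: extend_def sub_alpha_def \<sigma>_def)

text \<open>Subdividing does nothing when all blocks have length \<open>1\<close>: a word of the subdivided alphabet
  is covered by itself, and by no other word of at most that length.\<close>

lemma hat_mass_letter_morphism:
  assumes "v \<in> lists A"
  shows "hat_mass A \<sigma> \<mu> (map (\<lambda>a. (a, 1)) v) = measure \<mu> (cylinder A v)"
proof -
  let ?u = "map (\<lambda>a. (a, 1::nat)) v"
  have inj: "inj (\<lambda>a. (a, 1::nat))" by (simp add: inj_def)
  have cov: "covers A \<sigma> ?u v"
    using assms by (simp add: covers_def extend_sub_pi_letter_morphism)
  have len: "length v \<le> length v'" if "covers A \<sigma> ?u v'" for v'
    using sublist_length_le that by (fastforce simp: covers_def extend_sub_pi_letter_morphism)
  have uniq: "v' = v" if "covers A \<sigma> ?u v'" "length v' \<le> length v" for v'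
  proof -
    have sub: "sublist ?u (map (\<lambda>a. (a, 1)) v')"
      using that(1) by (simp add: covers_def extend_sub_pi_letter_morphism)
    then obtain p s where ps: "map (\<lambda>a. (a, 1)) v' = p @ ?u @ s" by (auto simp: sublist_def)
    then have "length v' = length p + length v + length s" by (metis length_append length_map add.assoc)
    then have "p = []" "s = []" using that(2) by auto
    with ps have "map (\<lambda>a. (a, 1::nat)) v' = ?u" by simp
    then show ?thesis using inj by (rule map_injective)
  qed
  have "hat_word A \<sigma> ?u = v"
    unfolding hat_word_def
  proof (rule the_equality)
    show "is_arg_min length (covers A \<sigma> ?u) v"
      using cov len by (auto simp: is_arg_min_def not_less)
    show "v' = v" if "is_arg_min length (covers A \<sigma> ?u) v'" for v'
      using that cov uniq[of v'] by (auto simp: is_arg_min_def not_less)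
  qed
  then show ?thesis using cov by (auto simp: hat_mass_def)
qed

lemma sum_hat_mass_letter_morphism:
  "(\<Sum>u\<in>{u \<in> lists (sub_alphabet A \<sigma>). extend (sub_alpha \<sigma>) u = w}. hat_mass A \<sigma> \<mu> u)
     = (\<Sum>v\<in>{v \<in> lists A. map f v = w}. measure \<mu> (cylinder A v))"
proof (rule sum.reindex_cong[where l = "map (\<lambda>a. (a, 1))"])
  show "inj_on (map (\<lambda>a. (a, 1::nat))) {v \<in> lists A. map f v = w}"
    by (simp add: inj_on_def inj_def inj_map_eq_map)
  show "{u \<in> lists (sub_alphabet A \<sigma>). extend (sub_alpha \<sigma>) u = w}
      = map (\<lambda>a. (a, 1)) ` {v \<in> lists A. map f v = w}"
    unfolding sub_alphabet_letter_morphism lists_image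
    using extend_sub_alpha_letter_morphism by force
qed (simp add: hat_mass_letter_morphism del: One_nat_def)

end

section \<open>Transferring a point mass\<close>

text \<open>The map that pushes \<open>\<mu>\<close> forward is constant, so only the total mass of \<open>\<mu>\<close> enters.\<close>

definition zero_point_mass :: "nat set \<Rightarrow> (int \<Rightarrow> nat) measure \<Rightarrow> (int \<Rightarrow> nat) measure" where
  "zero_point_mass B \<mu> = distr \<mu> (shift_borel B) (\<lambda>_. zero_word)"

lemma emeasure_zero_point_mass:
  assumes "0 \<in> B" "E \<in> sets (shift_borel B)"
  shows "emeasure (zero_point_mass B \<mu>) E = (if zero_word \<in> E then emeasure \<mu> (space \<mu>) else 0)"
proof -
  have "(\<lambda>_. zero_word) \<in> measurable \<mu> (shift_borel B)"
    using assms(1) by (simp add: zero_word_in_full_shift)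
  then show ?thesis
    using assms(2) by (auto simp: zero_point_mass_def emeasure_distr)
qed

text \<open>A point mass at a fixed point of the shift is invariant, and at any other word some letter is
  non-zero, which cuts out an open null neighbourhood of that word.\<close>

lemma zero_point_mass_invariant:
  assumes "0 \<in> B" "finite_measure \<mu>" "zero_word \<in> Y"
  shows "zero_point_mass B \<mu> \<in> invariant_measures B Y"
proof -
  let ?\<nu> = "zero_point_mass B \<mu>"
  have sets: "sets ?\<nu> = sets (shift_borel B)" and space: "space ?\<nu> = full_shift B"
    by (simp_all add: zero_point_mass_def)
  have fin: "finite_measure ?\<nu>"
    unfolding zero_point_mass_def
    using assms by (intro finite_measure.finite_measure_distr) (auto simp: zero_word_in_full_shift)
  have inv: "emeasure ?\<nu> (shift_map -` E \<inter> full_shift B) = emeasure ?\<nu> E"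
    if E: "E \<in> sets (shift_borel B)" for E
    using measurable_sets[OF measurable_shift_map E] assms(1) E
    by (simp add: emeasure_zero_point_mass shift_map_zero_word zero_word_in_full_shift)
  have "x = zero_word" if x: "x \<in> measure_support B ?\<nu>" for x
  proof
    fix k
    show "x k = zero_word k"
    proof (rule ccontr)
      assume "x k \<noteq> zero_word k"
      then have "x \<in> {z \<in> full_shift B. z k \<in> - {0}}"
        using x by (simp add: measure_support_def zero_word_def)
      then have "emeasure ?\<nu> {z \<in> full_shift B. z k \<in> - {0}} > 0"
        using x openin_letter[of B k "- {0}"] unfolding measure_support_def by blast
      then show False
        by (subst (asm) emeasure_zero_point_mass[OF assms(1) letter_in_sets])
          (simp add: zero_word_def)
    qed
  qed
  then show ?thesis
    using sets space fin inv assms(3) by (auto simp: invariant_measures_def)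
qed

text \<open>Only cylinders of words \<open>0\<dots>0\<close> have mass under \<open>\<mu>\<close>, and \<open>f\<close> sends these words to
  themselves. The cylinder formula therefore gives no mass to a word containing a non-zero letter,
  and invariance forces every solution to be concentrated at the zero word.\<close>

lemma measure_transfer_eq_zero_point_mass:
  fixes f :: "nat \<Rightarrow> nat"
  assumes A: "finite A" "0 \<in> A" and B: "finite B" "0 \<in> B" and f0: "f 0 = 0"
    and \<mu>: "\<mu> \<in> invariant_measures A X"
    and null: "emeasure \<mu> {x \<in> full_shift A. x 1 \<noteq> 0} = 0"
  shows "measure_transfer A B (\<lambda>a. [f a]) \<mu> = zero_point_mass B \<mu>"
proof -
  let ?c = "measure \<mu> (full_shift A)"
  have space: "space \<mu> = full_shift A" and fin: "finite_measure \<mu>"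
    using invariant_measuresD[OF \<mu>] by auto
  have cyl: "measure \<mu> (cylinder A v) = (if v = replicate (length v) 0 then ?c else 0)" for v
    using emeasure_of_nonzero_letter_null[OF \<mu> null cylinder_in_sets, of v]
    by (simp add: measure_def zero_word_in_cylinder A(2))
  have mass: "(\<Sum>v\<in>{v \<in> lists A. map f v = w}. measure \<mu> (cylinder A v))
      = (if w = replicate (length w) 0 then ?c else 0)" for w
  proof -
    let ?S = "{v \<in> lists A. map f v = w}" and ?z = "replicate (length w) (0::nat)"
    have "finite {v. set v \<subseteq> A \<and> length v = length w}"
      using A(1) by (rule finite_lists_length_eq)
    then have finS: "finite ?S" by (rule rev_finite_subset) auto
    have "(\<Sum>v\<in>?S. measure \<mu> (cylinder A v)) = (\<Sum>v\<in>?S. if v = ?z then ?c else 0)"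
      by (rule sum.cong) (auto simp: cyl)
    also have "\<dots> = (if ?z \<in> ?S then ?c else 0)" using finS by simp
    also have "?z \<in> ?S \<longleftrightarrow> w = ?z"
    proof -
      have "map f ?z = ?z" by (simp add: f0)
      moreover have "?z \<in> lists A" using A(2) by auto
      ultimately show ?thesis by (metis (mono_tags, lifting) mem_Collect_eq)
    qed
    finally show ?thesis .
  qed
  let ?P = "\<lambda>\<nu>. \<nu> \<in> invariant_measures B (full_shift B) \<and>
     (\<forall>w\<in>lists B. w \<noteq> [] \<longrightarrow> measure \<nu> (cylinder B w) = (if w = replicate (length w) 0 then ?c else 0))"
  have "(THE \<nu>. ?P \<nu>) = zero_point_mass B \<mu>"
  proof (rule the_equality)
    show "?P (zero_point_mass B \<mu>)"
      using zero_point_mass_invariant[OF B(2) fin, of "full_shift B"] B(2)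
        emeasure_zero_point_mass[OF B(2) cylinder_in_sets]
      by (auto simp: zero_word_in_full_shift zero_word_in_cylinder measure_def space)
  next
    fix \<nu> assume P: "?P \<nu>"
    then have \<nu>: "\<nu> \<in> invariant_measures B (full_shift B)" by simp
    note sets = invariant_measuresD(1)[OF \<nu>]
    interpret \<nu>: finite_measure \<nu> by (rule invariant_measuresD(3)[OF \<nu>])
    have formula: "measure \<nu> (cylinder B [b]) = (if b = 0 then ?c else 0)" if "b \<in> B" for b
      using P[THEN conjunct2, rule_format, of "[b]"] that by simp
    have "cylinder B [b] \<in> null_sets \<nu>" if "b \<in> B - {0}" for b
    proof (rule null_setsI)
      show "emeasure \<nu> (cylinder B [b]) = 0"
        using formula[of b] that by (simp add: \<nu>.emeasure_eq_measure)
      show "cylinder B [b] \<in> sets \<nu>" unfolding sets by (rule cylinder_in_sets)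
    qed
    then have "(\<Union>b\<in>B - {0}. cylinder B [b]) \<in> null_sets \<nu>"
      using B(1) by (intro null_sets_UN') (auto intro: countable_finite)
    moreover have "(\<Union>b\<in>B - {0}. cylinder B [b]) = {x \<in> full_shift B. x 1 \<noteq> 0}"
      by (auto simp: cylinder_def full_shift_def)
    ultimately have null': "emeasure \<nu> {x \<in> full_shift B. x 1 \<noteq> 0} = 0"
      by (auto simp: null_sets_def)
    note conc = emeasure_of_nonzero_letter_null[OF \<nu> null']
    have "measure \<nu> (cylinder B [0]) = ?c" using formula B(2) by simp
    moreover have "measure \<nu> (cylinder B [0]) = measure \<nu> (full_shift B)"
      using conc[OF cylinder_in_sets, of "[0]"] B(2)
      by (simp add: measure_def zero_word_in_cylinder)
    ultimately have total: "emeasure \<nu> (full_shift B) = emeasure \<mu> (full_shift A)"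
      by (simp add: \<nu>.emeasure_eq_measure finite_measure.emeasure_eq_measure[OF fin])
    show "\<nu> = zero_point_mass B \<mu>"
    proof (rule measure_eqI)
      show "sets \<nu> = sets (zero_point_mass B \<mu>)" by (simp add: sets zero_point_mass_def)
      show "emeasure \<nu> E = emeasure (zero_point_mass B \<mu>) E" if "E \<in> sets \<nu>" for E
        using that conc[of E] by (simp add: sets emeasure_zero_point_mass B(2) total space)
    qed
  qed
  then show ?thesis
    by (simp add: measure_transfer_def sum_hat_mass_letter_morphism mass)
qed

section \<open>Measure transfer can be injective without recognizability\<close>

lemma shift_map_power: "(shift_map ^^ n) x = (\<lambda>k. x (k + int n))"
  by (induction n arbitrary: x) (auto simp: shift_map_def ac_simps)

text \<open>A period would move the only non-zero letter, at position \<open>1\<close>, to another position.\<close>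

lemma not_periodic_single_letter: "\<not> periodic_word (zero_word(1 := Suc a))"
proof
  assume "periodic_word (zero_word(1 := Suc a))"
  then obtain m where m: "m \<ge> 1" "(shift_map ^^ m) (zero_word(1 := Suc a)) = zero_word(1 := Suc a)"
    by (auto simp: periodic_word_def)
  have "(shift_map ^^ m) (zero_word(1 := Suc a)) 1 = 0"
    using m(1) by (simp add: shift_map_power zero_word_def)
  with m(2) show False by simp
qed

theorem proposition5p10:
  "\<exists>(A :: nat set) (B :: nat set) (X :: (int \<Rightarrow> nat) set) (\<sigma> :: nat \<Rightarrow> nat list).
     alphabet A \<and> alphabet B \<and> subshift A X \<and>
     word_morphism A B \<sigma> \<and> non_erasing A \<sigma> \<and>
     \<not> recognizable_aperiodic B \<sigma> X \<and>
     measure_transfer_on A B \<sigma> X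
       \<in> invariant_measures A X \<rightarrow> invariant_measures B (image_subshift B \<sigma> X) \<and>
     inj_on (measure_transfer_on A B \<sigma> X) (invariant_measures A X)"
proof -
  let ?A = "{0, 1, 2 :: nat}" and ?B = "{0, 1 :: nat}"
  define f :: "nat \<Rightarrow> nat" where "f = min 1"
  let ?X = "sparse_words ?A" and ?\<sigma> = "\<lambda>a. [f a]"
  let ?M = "invariant_measures ?A ?X"
  let ?y = "zero_word(1 := Suc 0)"

  have image: "biinfinite_image ?\<sigma> (zero_word(1 := a)) = ?y" if "a \<in> {1, 2}" for a
    using that by (auto simp: biinfinite_image_letter_morphism f_def zero_word_def)
  have X: "zero_word(1 := a) \<in> ?X" if "a \<in> ?A" for a
    using that by (auto simp: sparse_words_def full_shift_def zero_word_def)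
  have "\<not> recognizable_aperiodic ?B ?\<sigma> ?X"
  proof
    assume recog: "recognizable_aperiodic ?B ?\<sigma> ?X"
    have y: "?y \<in> full_shift ?B" by (auto simp: full_shift_def zero_word_def)
    have "zero_word(1 := 1) = zero_word(1 := 2) \<and> (0::nat) = 0"
      by (rule recog[unfolded recognizable_aperiodic_def, rule_format, OF X X y not_periodic_single_letter])
        (simp_all add: image)
    then have "(zero_word(1 := 1)) 1 = (zero_word(1 := 2)) (1::int)" by metis
    then show False by simp
  qed
  moreover have transfer: "measure_transfer_on ?A ?B ?\<sigma> ?X \<mu> = zero_point_mass ?B \<mu>" if "\<mu> \<in> ?M" for \<mu>
    using that nonzero_letter_null_of_sparse_support[OF _ that]
    by (simp add: measure_transfer_on_def)
      (rule measure_transfer_eq_zero_point_mass, auto simp: f_def)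
  have "zero_word \<in> image_subshift ?B ?\<sigma> ?X"
  proof -
    have "zero_word \<in> ?X" using X[of 0] by (simp add: zero_word_def fun_upd_def)
    moreover have "biinfinite_image ?\<sigma> zero_word = zero_word"
      by (simp add: biinfinite_image_letter_morphism f_def zero_word_def)
    ultimately show ?thesis unfolding image_subshift_def by force
  qed
  then have "measure_transfer_on ?A ?B ?\<sigma> ?X \<in> ?M \<rightarrow> invariant_measures ?B (image_subshift ?B ?\<sigma> ?X)"
    by (intro funcsetI) (simp only: transfer zero_point_mass_invariant invariant_measuresD(3) insertI1)
  moreover have "inj_on (measure_transfer_on ?A ?B ?\<sigma> ?X) ?M"
  proof (rule inj_onI)
    fix \<mu> \<mu>' assume \<mu>: "\<mu> \<in> ?M" and \<mu>': "\<mu>' \<in> ?M"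
      and "measure_transfer_on ?A ?B ?\<sigma> ?X \<mu> = measure_transfer_on ?A ?B ?\<sigma> ?X \<mu>'"
    then have "zero_point_mass ?B \<mu> = zero_point_mass ?B \<mu>'"
      by (simp only: transfer[OF \<mu>] transfer[OF \<mu>'])
    then have "emeasure (zero_point_mass ?B \<mu>) (full_shift ?B)
        = emeasure (zero_point_mass ?B \<mu>') (full_shift ?B)" by simp
    then have total: "emeasure \<mu> (full_shift ?A) = emeasure \<mu>' (full_shift ?A)"
      using sets.top[of "shift_borel ?B"]
      by (simp add: emeasure_zero_point_mass zero_word_in_full_shift
          invariant_measuresD(2)[OF \<mu>] invariant_measuresD(2)[OF \<mu>'])
    note conc = emeasure_of_nonzero_letter_null[OF _ nonzero_letter_null_of_sparse_support]
    show "\<mu> = \<mu>'"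
    proof (rule measure_eqI)
      show "sets \<mu> = sets \<mu>'"
        using invariant_measuresD(1)[OF \<mu>] invariant_measuresD(1)[OF \<mu>'] by simp
      show "emeasure \<mu> E = emeasure \<mu>' E" if "E \<in> sets \<mu>" for E
        using that invariant_measuresD(1)[OF \<mu>] conc[OF \<mu> _ \<mu>, of E] conc[OF \<mu>' _ \<mu>', of E] total
        by simp
    qed
  qed
  moreover have "alphabet ?A" "alphabet ?B" by (simp_all add: alphabet_def)
  moreover have "subshift ?A ?X" by (rule subshift_sparse_words) simp
  moreover have "word_morphism ?A ?B ?\<sigma>" "non_erasing ?A ?\<sigma>"
    by (auto simp: word_morphism_def non_erasing_def f_def)
  ultimately show ?thesis by blast
qed

end
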